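(* Let $m\ge 3$ and $k\ge 1$ be integers, let $P_{m,k}$ be the generalized Petersen graph of order $2m$, and let $T$ be a tree of order $n$. Put $d_p=\mathrm{diam}(P_{m,k})$, $d_t=\mathrm{diam}(T)$ and $\varepsilon=\varepsilon(T)$. Then $$\mathrm{rn}(P_{m,k}\Box T)\;\ge\;(2mn-1)(d_t+\varepsilon)-4m\,L(T).$$ Moreover, equality holds if and only if there exists an ordering $z_0,z_1,\ldots,z_{2mn-1}$ of $V(P_{m,k}\Box T)$, where $z_t=(x_{i_t},y_{j_t})$ with $x_{i_t}\in V(P_{m,k})$ and $y_{j_t}\in V(T)$, such that all of the following hold (for all $0\le t\le 2mn-2$): (a) $d_{P_{m,k}}(x_{i_t},x_{i_{t+1}})=d_p$; (b) $L_T(y_{j_0})+L_T(y_{j_{2mn-1}})=0$; (c) $y_{j_t}$ and $y_{j_{t+1}}$ are in different branches of $T$ when $|W(T)|=1$, and in opposite branches of $T$ when $|W(T)|=2$; (d) the mapping $f$ defined by $f(z_0)=0$ and $f(z_{t+1})=f(z_t)+d_t+\varepsilon-L_T(y_{j_t})-L_T(y_{j_{t+1}})$ is a radio labeling of $P_{m,k}\Box T$.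
   Context: Radio labeling: for a connected graph $G$, a radio labeling is a map $f:V(G)\to\{0,1,2,\ldots\}$ with $|f(u)-f(v)|\ge \mathrm{diam}(G)+1-d_G(u,v)$ for all distinct $u,v\in V(G)$. Its span is $\max\{|f(u)-f(v)|:u,v\in V(G)\}$, and the radio number $\mathrm{rn}(G)$ is the minimum span over all radio labelings of $G$. Generalized Petersen graph: for $m\ge 3$, $k\ge 1$, $P_{m,k}$ has vertex set $\{u_i,v_i:i\in\mathbb{Z}_m\}$ and edge set $\{u_iu_{i+1},\,u_iv_i,\,v_iv_{i+k}:i\in\mathbb{Z}_m\}$ (indices mod $m$). Cartesian product: $G\Box H$ has vertex set $V(G)\times V(H)$, with $(g,h)$ and $(g',h')$ adjacent iff ($g g'\in E(G)$ and $h=h'$) or ($g=g'$ and $hh'\in E(H)$). Weight centers: for a tree $T$, $w_T(u)=\sum_{v\in V(T)}d_T(u,v)$; a weight center is a vertex minimizing $w_T$, and $W(T)$ is the set of weight centers. It is known that $|W(T)|\in\{1,2\}$, and if $W(T)=\{w,w'\}$ then $ww'$ is an edge of $T$. Set $\varepsilon(T)=1$ if $|W(T)|=1$ and $\varepsilon(T)=0$ if $|W(T)|=2$. Levels: $L_T(x)=\min\{d_T(x,w):w\in W(T)\}$ and $L(T)=\sum_{x\in V(T)}L_T(x)$. Branches: $T$ is viewed as rooted at its weight center(s). For a vertex $u\notin W(T)$ adjacent to a weight center, the subtree induced by $u$ and all its descendants is a branch. When $|W(T)|=1$, two vertices $x,y$ are in different branches if they lie in branches induced by different neighbours of the weight center,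 or if at least one of them is the weight center (in particular the weight center is considered to be in a different branch from itself). When $W(T)=\{w,w'\}$, two vertices are in opposite branches if they lie in different components of $T-ww'$ (the graph obtained by deleting the edge $ww'$). *)

theory Defs
  imports "Graph_Theory.Graph_Theory"
begin

text \<open>
  Undirected graphs are symmetric digraphs without parallel arcs
  (\<^typ>\<open>'a pair_pre_digraph\<close>): an edge \<open>uv\<close> is the pair of arcs \<open>(u,v)\<close> and \<open>(v,u)\<close>.
\<close>

definition graph_dist :: "'a pair_pre_digraph \<Rightarrow> 'a \<Rightarrow> 'a \<Rightarrow> nat" where
  "graph_dist G u v = (LEAST l. \<exists>p. pre_digraph.awalk (with_proj G) u p v \<and> length p = l)"

definition diameter :: "'a pair_pre_digraph \<Rightarrow> nat" where
  "diameter G = Max {graph_dist G u v | u v. u \<in> pverts G \<and> v \<in> pverts G}"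

text \<open>
  The library's \<^const>\<open>tree\<close> does not fit here: in a symmetric digraph every edge already
  yields a directed cycle \<open>u, v, u\<close> of length two. A cycle of the underlying undirected simple
  graph is a directed cycle of length at least three.
\<close>

definition undirected_tree :: "'a pair_pre_digraph \<Rightarrow> bool" where
  "undirected_tree T \<longleftrightarrow> pair_graph T \<and> connected (with_proj T) \<and>
     \<not> (\<exists>p. pre_digraph.cycle (with_proj T) p \<and> 3 \<le> length p)"

definition radio_labeling :: "'a pair_pre_digraph \<Rightarrow> ('a \<Rightarrow> nat) \<Rightarrow> bool" where
  "radio_labeling G f \<longleftrightarrow>
     (\<forall>u\<in>pverts G. \<forall>v\<in>pverts G. u \<noteq> v \<longrightarrow>
        \<bar>int (f u) - int (f v)\<bar> \<ge> int (diameter G) + 1 - int (graph_dist G u v))"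

definition label_span :: "'a pair_pre_digraph \<Rightarrow> ('a \<Rightarrow> nat) \<Rightarrow> nat" where
  "label_span G f = Max {nat \<bar>int (f u) - int (f v)\<bar> | u v. u \<in> pverts G \<and> v \<in> pverts G}"

definition radio_number :: "'a pair_pre_digraph \<Rightarrow> nat" where
  "radio_number G = (LEAST s. \<exists>f. radio_labeling G f \<and> label_span G f = s)"

text \<open>
  The index set \<open>\<int>\<^sub>m\<close> is represented by \<open>{..<m}\<close>. If \<open>m\<close> divides \<open>k\<close>, the arcs between
  inner vertices are loops; these have no influence on distances.
\<close>

datatype petersen_vertex = Outer nat | Inner nat

definition petersen :: "nat \<Rightarrow> nat \<Rightarrow> petersen_vertex pair_pre_digraph" where
  "petersen m k =
     (let E = {(Outer i, Outer ((i + 1) mod m)) | i. i < m}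
            \<union> {(Outer i, Inner i) | i. i < m}
            \<union> {(Inner i, Inner ((i + k) mod m)) | i. i < m}
      in \<lparr> pverts = Outer ` {..<m} \<union> Inner ` {..<m}, parcs = E \<union> E\<inverse> \<rparr>)"

definition cartesian_product ::
  "'a pair_pre_digraph \<Rightarrow> 'b pair_pre_digraph \<Rightarrow> ('a \<times> 'b) pair_pre_digraph" (infixr "\<box>" 70) where
  "G \<box> H =
     \<lparr> pverts = pverts G \<times> pverts H,
       parcs = {((g, h), (g', h')) | g h g' h'.
                  ((g, g') \<in> parcs G \<and> h = h' \<and> h \<in> pverts H) \<or>
                  (g = g' \<and> g \<in> pverts G \<and> (h, h') \<in> parcs H)} \<rparr>"

definition vertex_weight :: "'a pair_pre_digraph \<Rightarrow> 'a \<Rightarrow> nat" where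
  "vertex_weight T u = (\<Sum>v\<in>pverts T. graph_dist T u v)"

definition weight_centers :: "'a pair_pre_digraph \<Rightarrow> 'a set" where
  "weight_centers T = {u \<in> pverts T. \<forall>v\<in>pverts T. vertex_weight T u \<le> vertex_weight T v}"

definition epsilon :: "'a pair_pre_digraph \<Rightarrow> nat" where
  "epsilon T = (if card (weight_centers T) = 1 then 1 else 0)"

definition level :: "'a pair_pre_digraph \<Rightarrow> 'a \<Rightarrow> nat" where
  "level T x = Min (graph_dist T x ` weight_centers T)"

definition total_level :: "'a pair_pre_digraph \<Rightarrow> nat" where
  "total_level T = (\<Sum>x\<in>pverts T. level T x)"

text \<open>
  \<open>x\<close> is \<open>u\<close> or a descendant of \<open>u\<close> iff \<open>u\<close> lies on the path to \<open>x\<close> from its root, the root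
  of \<open>x\<close> being the weight center from which \<open>x\<close> is reached without passing through another
  weight center.
\<close>

definition branch :: "'a pair_pre_digraph \<Rightarrow> 'a \<Rightarrow> 'a set" where
  "branch T u =
     {x. \<exists>w\<in>weight_centers T. \<exists>p. pre_digraph.apath (with_proj T) w p x \<and>
           set (pawalk_verts w p) \<inter> weight_centers T = {w} \<and>
           u \<in> set (pawalk_verts w p)}"

definition branch_roots :: "'a pair_pre_digraph \<Rightarrow> 'a set" where
  "branch_roots T = {u \<in> pverts T - weight_centers T. \<exists>w\<in>weight_centers T. (w, u) \<in> parcs T}"

text \<open>Intended for trees with a single weight center.\<close>

definition different_branches :: "'a pair_pre_digraph \<Rightarrow> 'a \<Rightarrow> 'a \<Rightarrow> bool" where
  "different_branches T x y \<longleftrightarrow>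
     x \<in> weight_centers T \<or> y \<in> weight_centers T \<or>
     (\<exists>u\<in>branch_roots T. \<exists>u'\<in>branch_roots T. u \<noteq> u' \<and> x \<in> branch T u \<and> y \<in> branch T u')"

definition delete_edge :: "'a pair_pre_digraph \<Rightarrow> 'a \<Rightarrow> 'a \<Rightarrow> 'a pair_pre_digraph" where
  "delete_edge G u v = \<lparr> pverts = pverts G, parcs = parcs G - {(u, v), (v, u)} \<rparr>"

text \<open>
  Intended for trees with two weight centers. In a symmetric digraph, two vertices lie in
  different components iff neither is reachable from the other.
\<close>

definition opposite_branches :: "'a pair_pre_digraph \<Rightarrow> 'a \<Rightarrow> 'a \<Rightarrow> bool" where
  "opposite_branches T x y \<longleftrightarrow>
     (\<exists>w w'. w \<noteq> w' \<and> weight_centers T = {w, w'} \<and> x \<in> pverts T \<and> y \<in> pverts T \<and>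
        \<not> (x \<rightarrow>\<^sup>*\<^bsub>with_proj (delete_edge T w w')\<^esub> y))"

end

theory Submission
  imports Defs
begin

text \<open>
  Sort the vertices of \<open>G \<box> T\<close> by their labels as \<open>z\<^sub>0, \<dots>, z\<^sub>N\<close>. Since distances and
  diameters of a Cartesian product add up, and distances in \<open>G\<close> are at most \<open>diameter G\<close>, two
  consecutive vertices with tree coordinates \<open>y, y'\<close> have labels that differ by at least
  \<open>diameter T + 1 - d(y, y')\<close>. In the tree, \<open>d(y, y') + epsilon T \<le> level y + level y' + 1\<close>: go
  from \<open>y\<close> up to its nearest weight center and down to \<open>y'\<close> from the nearest one of \<open>y'\<close>, using
  the edge between the centers if there are two. Hence each difference is at least
  \<open>diameter T + epsilon T - level y - level y'\<close>. Adding this up along the ordering, every vertex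
  contributes its level twice except the two end vertices, whose levels are counted once; this
  gives the lower bound. It is attained exactly when nothing is lost anywhere: distance
  \<open>diameter G\<close> in the graph coordinate, equality in the tree inequality at each step, and level
  zero at both ends. The labeling is then determined by the ordering up to a shift. Conversely,
  for an ordering of this kind the prescribed labels are nondecreasing, so that their span is the
  difference between the last and the first one, which telescopes to the bound.

  The argument is carried out for the product of any finite connected graph \<open>G\<close> and a tree;
  generalized Petersen graphs are connected and have order \<open>2 * m\<close>.

  What is specific to trees is the case of equality in the tree inequality, lemma
  \<open>dist_le_levels\<close>: it holds exactly for vertices in different or opposite branches. All of it is
  derived from one consequence of acyclicity (\<open>neighbours_separated\<close>): two distinct neighbours of
  a vertex \<open>b\<close> cannot be joined by a walk that avoids \<open>b\<close>. It follows that at most one neighbour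
  of \<open>b\<close> is at least as close to a given vertex as \<open>b\<close> itself, which makes the weight strictly
  convex along paths and so restricts the weight centers to a single vertex or two adjacent ones.
\<close>

section \<open>The metric of a connected graph\<close>

text \<open>
  Loops are admitted since generalized Petersen graphs may have them. Walks are measured by
  relational powers of the arc relation, for which concatenation and induction on the length are
  immediate.
\<close>

locale connected_graph = pair_pseudo_graph G for G :: "'a pair_pre_digraph" +
  assumes verts_nonempty: "pverts G \<noteq> {}"
    and arcs_connected: "u \<in> pverts G \<Longrightarrow> v \<in> pverts G \<Longrightarrow> (u, v) \<in> (parcs G)\<^sup>*"
begin

lemma walk_iff_relpow:
  "u \<in> pverts G \<Longrightarrow> (\<exists>p. awalk u p v \<and> length p = l) \<longleftrightarrow> (u, v) \<in> parcs G ^^ l"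
proof (induction l arbitrary: u)
  case 0
  then show ?case by (auto simp: awalk_simps)
next
  case (Suc l)
  have "(\<exists>p. awalk u p v \<and> length p = Suc l) \<longleftrightarrow>
      (\<exists>u'. (u, u') \<in> parcs G \<and> (\<exists>p. awalk u' p v \<and> length p = l))"
    (is "?L \<longleftrightarrow> ?R")
  proof
    assume ?L
    then obtain e p where "awalk u (e # p) v" "length p = l"
      by (metis length_Suc_conv)
    then show ?R
      by (intro exI[of _ "snd e"]) (auto simp: awalk_Cons_iff)
  next
    assume ?R
    then obtain u' p where "(u, u') \<in> parcs G" "awalk u' p v" "length p = l"
      by blast
    then show ?L
      by (intro exI[of _ "(u, u') # p"]) (auto simp: awalk_Cons_iff)
  qed
  also have "\<dots> \<longleftrightarrow> (\<exists>u'. (u, u') \<in> parcs G \<and> (u', v) \<in> parcs G ^^ l)"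
    using Suc.IH in_arcsD2 by blast
  also have "\<dots> \<longleftrightarrow> (u, v) \<in> parcs G ^^ Suc l"
    by (meson relpow_Suc_D2 relpow_Suc_I2)
  finally show ?case .
qed

lemma graph_dist_relpow:
  "u \<in> pverts G \<Longrightarrow> graph_dist G u v = (LEAST l. (u, v) \<in> parcs G ^^ l)"
  using walk_iff_relpow by (simp add: graph_dist_def)

lemma dist_le:
  assumes "u \<in> pverts G" "(u, v) \<in> parcs G ^^ l"
  shows "graph_dist G u v \<le> l"
  using assms by (simp add: graph_dist_relpow Least_le)

lemma dist_walk:
  assumes "u \<in> pverts G" "v \<in> pverts G"
  shows "(u, v) \<in> parcs G ^^ graph_dist G u v"
proof -
  have "\<exists>l. (u, v) \<in> parcs G ^^ l"
    using arcs_connected[OF assms] by (simp add: rtrancl_power)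
  then show ?thesis
    unfolding graph_dist_relpow[OF assms(1)] by (rule LeastI_ex)
qed

lemma dist_self [simp]: "u \<in> pverts G \<Longrightarrow> graph_dist G u u = 0"
  using dist_le[of u u 0] by simp

lemma dist_eq_0_iff:
  "u \<in> pverts G \<Longrightarrow> v \<in> pverts G \<Longrightarrow> graph_dist G u v = 0 \<longleftrightarrow> u = v"
  using dist_walk[of u v] by auto

lemma dist_triangle:
  assumes "u \<in> pverts G" "v \<in> pverts G" "w \<in> pverts G"
  shows "graph_dist G u w \<le> graph_dist G u v + graph_dist G v w"
  using assms dist_walk[of u v] dist_walk[of v w]
  by (intro dist_le) (auto simp: relpow_add)

lemma dist_sym:
  assumes "u \<in> pverts G" "v \<in> pverts G"
  shows "graph_dist G u v = graph_dist G v u"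
proof -
  have "(x, y) \<in> parcs G ^^ l \<Longrightarrow> (y, x) \<in> parcs G ^^ l" for x y l
  proof (induction l arbitrary: y)
    case (Suc l)
    then show ?case
      using arcs_symmetric by (meson relpow_Suc_E relpow_Suc_I2)
  qed simp
  then show ?thesis
    using assms dist_walk dist_le by (meson order_antisym)
qed

lemma dist_adjacent_le:
  assumes "(u, u') \<in> parcs G" "v \<in> pverts G"
  shows "graph_dist G u v \<le> Suc (graph_dist G u' v)"
  using assms in_arcsD1 in_arcsD2 dist_walk[of u' v] relpow_Suc_I2[of u u' "parcs G"]
  by (intro dist_le) auto

lemma geodesic_step:
  assumes "u \<in> pverts G" "v \<in> pverts G" "u \<noteq> v"
  obtains u' where "(u, u') \<in> parcs G" "graph_dist G u v = Suc (graph_dist G u' v)"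
proof -
  obtain l where l: "graph_dist G u v = Suc l"
    using assms dist_eq_0_iff not0_implies_Suc by blast
  then obtain u' where u': "(u, u') \<in> parcs G" "(u', v) \<in> parcs G ^^ l"
    using dist_walk[OF assms(1,2)] by (metis relpow_Suc_D2)
  then have "graph_dist G u' v \<le> l"
    using dist_le in_arcsD2 by blast
  then show thesis
    using that u' l dist_adjacent_le[OF u'(1) assms(2)] by simp
qed

lemma finite_distances: "finite {graph_dist G u v | u v. u \<in> pverts G \<and> v \<in> pverts G}"
  by (intro finite_image_set2) (simp_all add: pair_finite_verts)

lemma dist_le_diameter:
  "u \<in> pverts G \<Longrightarrow> v \<in> pverts G \<Longrightarrow> graph_dist G u v \<le> diameter G"
  unfolding diameter_def by (intro Max_ge finite_distances) blast

lemma diameter_attained: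
  obtains u v where "u \<in> pverts G" "v \<in> pverts G" "graph_dist G u v = diameter G"
proof -
  have "diameter G \<in> {graph_dist G u v | u v. u \<in> pverts G \<and> v \<in> pverts G}"
    unfolding diameter_def using verts_nonempty by (intro Max_in finite_distances) auto
  then show thesis
    using that by auto
qed

abbreviation arcs_avoiding :: "'a \<Rightarrow> 'a rel" where
  "arcs_avoiding b \<equiv> parcs G \<inter> (- {b}) \<times> (- {b})"

text \<open>
  Walk along a geodesic from \<open>u\<close> to \<open>v\<close>: each step shortens the left-hand side of the strict
  inequality by one and the right-hand side by at most one, so the inequality persists, whereas it
  would fail at \<open>b\<close>.
\<close>

lemma geodesic_avoids:
  assumes "u \<in> pverts G" "b \<in> pverts G" "v \<in> pverts G" "u \<noteq> b"
    and "graph_dist G u v < graph_dist G u b + graph_dist G b v"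
  shows "(u, v) \<in> (arcs_avoiding b)\<^sup>*"
  using assms
proof (induction "graph_dist G u v" arbitrary: u rule: less_induct)
  case less
  show ?case
  proof (cases "u = v")
    case False
    obtain u' where u': "(u, u') \<in> parcs G" "graph_dist G u v = Suc (graph_dist G u' v)"
      using geodesic_step less.prems False by metis
    have verts: "u' \<in> pverts G"
      using u' in_arcsD2 by blast
    have lt: "graph_dist G u' v < graph_dist G u' b + graph_dist G b v"
      using less.prems u' dist_adjacent_le[of u u' b] by simp
    then have "u' \<noteq> b"
      using verts by auto
    then have "(u', v) \<in> (arcs_avoiding b)\<^sup>*"
      using less.hyps[of u'] less.prems u' verts lt by simp
    moreover have "(u, u') \<in> arcs_avoiding b"
      using u' \<open>u' \<noteq> b\<close> less.prems by simp
    ultimately show ?thesis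
      by (rule converse_rtrancl_into_rtrancl[rotated])
  qed simp
qed

lemma walk_verts: "awalk u p v \<Longrightarrow> set (pawalk_verts u p) = insert u (snd ` set p)"
proof (induction p arbitrary: u)
  case (Cons e p)
  then have "awalk (snd e) p v" "fst e = u"
    by (auto simp: awalk_Cons_iff)
  then show ?case
    using Cons.IH[of "snd e"] by simp
qed simp

text \<open>
  Branches and cycles are defined by arc lists, whereas avoidance is handled as a relation; this
  lemma and the next one translate between the two.
\<close>

lemma avoiding_apath:
  assumes "u \<in> pverts G" "u \<noteq> b" "(u, v) \<in> (arcs_avoiding b)\<^sup>*"
  obtains p where "apath u p v" "b \<notin> set (pawalk_verts u p)"
proof -
  from assms(3) have "\<exists>p. awalk u p v \<and> b \<notin> snd ` set p"
  proof (induction rule: rtrancl_induct)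
    case base
    then show ?case using assms by (intro exI[of _ "[]"]) (simp add: awalk_simps)
  next
    case (step v v')
    then obtain p where p: "awalk u p v" "b \<notin> snd ` set p"
      by blast
    have "awalk v [(v, v')] v'"
      using step.hyps in_arcsD1 in_arcsD2 by (auto simp: awalk_simps)
    then have "awalk u (p @ [(v, v')]) v'"
      using p(1) by (rule awalk_appendI[rotated])
    then show ?case
      using p step.hyps by (intro exI[of _ "p @ [(v, v')]"]) auto
  qed
  then obtain p where p: "awalk u p v" "b \<notin> snd ` set p"
    by blast
  have apath: "apath u (awalk_to_apath p) v"
    using apath_awalk_to_apath[OF p(1)] .
  moreover have "b \<notin> set (pawalk_verts u (awalk_to_apath p))"
    using walk_verts[OF awalkI_apath[OF apath]] awalk_to_apath_subset[OF p(1)] p(2) assms(2)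
    by auto
  ultimately show thesis
    by (rule that)
qed

lemma walk_verts_reachable_avoiding:
  assumes "awalk u p v" "b \<notin> set (pawalk_verts u p)" "x \<in> set (pawalk_verts u p)"
  shows "(u, x) \<in> (arcs_avoiding b)\<^sup>*"
  using assms
proof (induction p arbitrary: u)
  case (Cons e p)
  have e: "awalk (snd e) p v" "e = (u, snd e)" "e \<in> parcs G"
    using Cons.prems by (auto simp: awalk_Cons_iff prod_eq_iff)
  have "snd e \<in> set (pawalk_verts (snd e) p)"
    using walk_verts[OF e(1)] by simp
  then have "(u, snd e) \<in> arcs_avoiding b"
    using Cons.prems e(2,3) by (cases e) auto
  then show ?case
    using Cons.prems Cons.IH[OF e(1)] e(2)
    by (cases "x = u") (auto intro: converse_rtrancl_into_rtrancl)
qed simp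

end

section \<open>Cartesian products\<close>

lemma relpow_product_left:
  "(g, g') \<in> parcs G ^^ i \<Longrightarrow> h \<in> pverts H \<Longrightarrow> ((g, h), (g', h)) \<in> parcs (G \<box> H) ^^ i"
proof (induction i arbitrary: g')
  case (Suc i)
  have arc: "((a, h), (b, h)) \<in> parcs (G \<box> H)" if "(a, b) \<in> parcs G" for a b
    using that Suc.prems by (simp add: cartesian_product_def)
  with Suc show ?case
    by auto
qed simp

lemma relpow_product_right:
  "(h, h') \<in> parcs H ^^ i \<Longrightarrow> g \<in> pverts G \<Longrightarrow> ((g, h), (g, h')) \<in> parcs (G \<box> H) ^^ i"
proof (induction i arbitrary: h')
  case (Suc i)
  have arc: "((g, a), (g, b)) \<in> parcs (G \<box> H)" if "(a, b) \<in> parcs H" for a b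
    using that Suc.prems by (simp add: cartesian_product_def)
  with Suc show ?case
    by auto
qed simp

text \<open>
  A walk in the product is a shuffle of a walk in each factor.
\<close>

lemma relpow_product_split:
  "((g, h), (g', h')) \<in> parcs (G \<box> H) ^^ l \<Longrightarrow>
    \<exists>i j. i + j = l \<and> (g, g') \<in> parcs G ^^ i \<and> (h, h') \<in> parcs H ^^ j"
proof (induction l arbitrary: g' h')
  case (Suc l)
  then obtain a b where ab: "((g, h), (a, b)) \<in> parcs (G \<box> H) ^^ l"
      "((a, b), (g', h')) \<in> parcs (G \<box> H)"
    by auto
  obtain i j where ij: "i + j = l" "(g, a) \<in> parcs G ^^ i" "(h, b) \<in> parcs H ^^ j"
    using Suc.IH[OF ab(1)] by blast
  consider "(a, g') \<in> parcs G" "b = h'" | "a = g'" "(b, h') \<in> parcs H"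
    using ab(2) by (auto simp: cartesian_product_def)
  then show ?case
  proof cases
    case 1
    then show ?thesis
      using ij by (intro exI[of _ "Suc i"] exI[of _ j]) auto
  next
    case 2
    then show ?thesis
      using ij by (intro exI[of _ i] exI[of _ "Suc j"]) auto
  qed
qed simp

lemma pverts_product [simp]: "pverts (G \<box> H) = pverts G \<times> pverts H"
  by (simp add: cartesian_product_def)

locale connected_graph_pair = G: connected_graph G + H: connected_graph H
  for G :: "'a pair_pre_digraph" and H :: "'b pair_pre_digraph"
begin

lemma product_walk:
  assumes "g \<in> pverts G" "g' \<in> pverts G" "h \<in> pverts H" "h' \<in> pverts H"
  shows "((g, h), (g', h')) \<in> parcs (G \<box> H) ^^ (graph_dist G g g' + graph_dist H h h')"
proof -
  have "((g, h), (g', h)) \<in> parcs (G \<box> H) ^^ graph_dist G g g'"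
    using assms by (intro relpow_product_left G.dist_walk)
  moreover have "((g', h), (g', h')) \<in> parcs (G \<box> H) ^^ graph_dist H h h'"
    using assms by (intro relpow_product_right H.dist_walk)
  ultimately show ?thesis
    by (auto simp: relpow_add)
qed

sublocale product: connected_graph "G \<box> H"
proof
  show wf: "fst e \<in> pverts (G \<box> H)" "snd e \<in> pverts (G \<box> H)" if "e \<in> parcs (G \<box> H)" for e
    using that G.in_arcsD1 G.in_arcsD2 H.in_arcsD1 H.in_arcsD2
    by (auto simp: cartesian_product_def)
  show fin: "finite (pverts (G \<box> H))"
    using G.pair_finite_verts H.pair_finite_verts by simp
  have "parcs (G \<box> H) \<subseteq> pverts (G \<box> H) \<times> pverts (G \<box> H)"
    using wf by (metis mem_Times_iff subsetI)
  then show "finite (parcs (G \<box> H))"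
    using fin by (meson finite_SigmaI finite_subset)
  show "symmetric (with_proj (G \<box> H))"
    using G.arcs_symmetric H.arcs_symmetric
    by (auto simp: symmetric_def cartesian_product_def intro!: symI)
  show "pverts (G \<box> H) \<noteq> {}"
    using G.verts_nonempty H.verts_nonempty by simp
  show "(u, v) \<in> (parcs (G \<box> H))\<^sup>*" if "u \<in> pverts (G \<box> H)" "v \<in> pverts (G \<box> H)" for u v
    using that product_walk[of "fst u" "fst v" "snd u" "snd v"]
    by (auto intro: relpow_imp_rtrancl)
qed

lemma dist_product:
  assumes "u \<in> pverts (G \<box> H)" "v \<in> pverts (G \<box> H)"
  shows "graph_dist (G \<box> H) u v = graph_dist G (fst u) (fst v) + graph_dist H (snd u) (snd v)"
proof (rule antisym)
  show "graph_dist (G \<box> H) u v \<le> graph_dist G (fst u) (fst v) + graph_dist H (snd u) (snd v)"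
    using assms product_walk[of "fst u" "fst v" "snd u" "snd v"] by (intro product.dist_le) auto
  obtain i j where "i + j = graph_dist (G \<box> H) u v"
      "(fst u, fst v) \<in> parcs G ^^ i" "(snd u, snd v) \<in> parcs H ^^ j"
    using product.dist_walk[OF assms] relpow_product_split[of "fst u" "snd u" "fst v" "snd v"]
    by fastforce
  then show "graph_dist G (fst u) (fst v) + graph_dist H (snd u) (snd v) \<le> graph_dist (G \<box> H) u v"
    using assms G.dist_le[of "fst u" "fst v" i] H.dist_le[of "snd u" "snd v" j] by auto
qed

lemma diameter_product: "diameter (G \<box> H) = diameter G + diameter H"
proof (rule antisym)
  obtain u v where "u \<in> pverts (G \<box> H)" "v \<in> pverts (G \<box> H)"
      "graph_dist (G \<box> H) u v = diameter (G \<box> H)"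
    by (rule product.diameter_attained)
  then show "diameter (G \<box> H) \<le> diameter G + diameter H"
    using G.dist_le_diameter H.dist_le_diameter
    by (metis add_mono dist_product mem_Times_iff pverts_product)
  obtain g g' where "g \<in> pverts G" "g' \<in> pverts G" "graph_dist G g g' = diameter G"
    by (rule G.diameter_attained)
  moreover obtain h h' where "h \<in> pverts H" "h' \<in> pverts H" "graph_dist H h h' = diameter H"
    by (rule H.diameter_attained)
  ultimately show "diameter G + diameter H \<le> diameter (G \<box> H)"
    using product.dist_le_diameter[of "(g, h)" "(g', h')"] dist_product[of "(g, h)" "(g', h')"]
    by simp
qed

end

section \<open>Trees\<close>

locale finite_tree =
  fixes T :: "'a pair_pre_digraph"
  assumes undirected_tree: "undirected_tree T"

sublocale finite_tree \<subseteq> pair_graph T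
  using undirected_tree by (simp add: undirected_tree_def)

sublocale finite_tree \<subseteq> connected_graph T
proof
  have conn: "strongly_connected (with_proj T)"
    using undirected_tree pair_sym_arcs
    by (intro symmetric_connected_imp_strongly_connected) (simp_all add: undirected_tree_def)
  then show "pverts T \<noteq> {}"
    by (auto simp: strongly_connected_def)
  show "(u, v) \<in> (parcs T)\<^sup>*" if "u \<in> pverts T" "v \<in> pverts T" for u v
    using conn that reachable_rtranclI[of "with_proj T" u v] by (simp add: strongly_connected_def)
qed

context finite_tree
begin

text \<open>
  A path from \<open>a\<close> to \<open>c\<close> that avoids \<open>b\<close>, closed up by the edges \<open>ba\<close> and \<open>cb\<close>, would be a cycle;
  it has length at least three because \<open>a \<noteq> c\<close>.
\<close>

lemma neighbours_separated:
  assumes "(b, a) \<in> parcs T" "(b, c) \<in> parcs T" "(a, c) \<in> (arcs_avoiding b)\<^sup>*"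
  shows "a = c"
proof (rule ccontr)
  assume "a \<noteq> c"
  have "a \<in> pverts T" "a \<noteq> b"
    using assms(1) in_arcsD2 no_loops' by auto
  then obtain p where p: "apath a p c" "b \<notin> set (pawalk_verts a p)"
    using avoiding_apath[OF _ _ assms(3)] by metis
  have walk: "awalk a p c"
    using p(1) by (rule awalkI_apath)
  have "p \<noteq> []"
    using \<open>a \<noteq> c\<close> walk by (auto simp: awalk_simps)
  have cb: "awalk c [(c, b)] b"
    using assms(2) arcs_symmetric in_arcsD1 in_arcsD2 by (auto simp: awalk_simps)
  have closed: "awalk b ((b, a) # p @ [(c, b)]) b"
    using awalk_appendI[OF walk cb] assms(1) in_arcsD1 by (auto simp: awalk_Cons_iff)
  have "pawalk_verts a (p @ [(c, b)]) = pawalk_verts a p @ [b]"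
    using awalk_verts_append[OF awalk_appendI[OF walk cb]] walk by auto
  then have "distinct (tl (pawalk_verts b ((b, a) # p @ [(c, b)])))"
    using p by (simp add: apath_def)
  then have "cycle ((b, a) # p @ [(c, b)])"
    using closed unfolding cycle_def by blast
  moreover have "3 \<le> length ((b, a) # p @ [(c, b)])"
    using \<open>p \<noteq> []\<close> by (cases p) auto
  ultimately show False
    using undirected_tree unfolding undirected_tree_def by blast
qed

text \<open>
  Geodesics from \<open>a\<close> and from \<open>c\<close> to \<open>v\<close> avoid \<open>b\<close>, and together they join \<open>a\<close> to \<open>c\<close>. For the root
  \<open>v\<close>, this is the uniqueness of parents.
\<close>

lemma closer_neighbour_unique:
  assumes "(b, a) \<in> parcs T" "(b, c) \<in> parcs T" "v \<in> pverts T"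
    and "graph_dist T a v \<le> graph_dist T b v" "graph_dist T c v \<le> graph_dist T b v"
  shows "a = c"
proof -
  have avoid: "(x, v) \<in> (arcs_avoiding b)\<^sup>*"
    if x: "(b, x) \<in> parcs T" "graph_dist T x v \<le> graph_dist T b v" for x
  proof -
    have "x \<in> pverts T" "b \<in> pverts T" "x \<noteq> b"
      using x(1) in_arcsD1 in_arcsD2 no_loops'[OF x(1)] by auto
    moreover from this have "0 < graph_dist T x b"
      using dist_eq_0_iff by blast
    ultimately show ?thesis
      using x assms(3) by (intro geodesic_avoids) auto
  qed
  have "sym (arcs_avoiding b)"
    using arcs_symmetric by (auto intro: symI)
  then have "(v, c) \<in> (arcs_avoiding b)\<^sup>*"
    using avoid[OF assms(2,5)] by (metis sym_rtrancl symD)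
  then have "(a, c) \<in> (arcs_avoiding b)\<^sup>*"
    using avoid[OF assms(1,4)] by (metis rtrancl_trans)
  then show ?thesis
    using neighbours_separated assms by blast
qed

text \<open>
  If \<open>a\<close> and \<open>b\<close> were equally far from \<open>v\<close>, then \<open>b\<close> and the next vertex on a geodesic from \<open>a\<close> to
  \<open>v\<close> would be two neighbours of \<open>a\<close> that are at least as close to \<open>v\<close> as \<open>a\<close>.
\<close>

lemma adjacent_dist_neq:
  assumes "(a, b) \<in> parcs T" "v \<in> pverts T"
  shows "graph_dist T a v \<noteq> graph_dist T b v"
proof
  assume eq: "graph_dist T a v = graph_dist T b v"
  have verts: "a \<in> pverts T" "b \<in> pverts T" "a \<noteq> b"
    using assms(1) in_arcsD1 in_arcsD2 no_loops' by auto
  then have "a \<noteq> v"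
    using eq assms(2) dist_eq_0_iff dist_self by metis
  then obtain c where c: "(a, c) \<in> parcs T" "graph_dist T a v = Suc (graph_dist T c v)"
    using geodesic_step verts assms(2) by metis
  then have "b = c"
    using closer_neighbour_unique[of a b c v] assms eq by simp
  then show False
    using c eq by simp
qed

section \<open>Weight centers\<close>

text \<open>
  Seen from any \<open>v\<close>, at least one of the two neighbours is farther away than \<open>b\<close>, which makes up
  for the other being possibly closer by one. For \<open>v = b\<close> both neighbours are farther away, and this
  makes the inequality strict.
\<close>

lemma weight_strictly_convex:
  assumes "(b, a) \<in> parcs T" "(b, c) \<in> parcs T" "a \<noteq> c"
  shows "2 * vertex_weight T b < vertex_weight T a + vertex_weight T c"
proof -
  have verts: "a \<in> pverts T" "b \<in> pverts T" "c \<in> pverts T"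
    using assms in_arcsD1 in_arcsD2 by auto
  have le: "2 * graph_dist T b v \<le> graph_dist T a v + graph_dist T c v" if "v \<in> pverts T" for v
  proof -
    have "graph_dist T b v < graph_dist T a v \<or> graph_dist T b v < graph_dist T c v"
      using closer_neighbour_unique[OF assms(1,2) that] assms(3) by linarith
    then show ?thesis
      using dist_adjacent_le[OF assms(1) that] dist_adjacent_le[OF assms(2) that] by linarith
  qed
  have "0 < graph_dist T a b"
    using verts assms(1) no_loops' dist_eq_0_iff by (metis gr0I)
  then have "\<exists>v\<in>pverts T. 2 * graph_dist T b v < graph_dist T a v + graph_dist T c v"
    using verts by (intro bexI[of _ b]) simp_all
  then have "(\<Sum>v\<in>pverts T. 2 * graph_dist T b v)
      < (\<Sum>v\<in>pverts T. graph_dist T a v + graph_dist T c v)"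
    using le pair_finite_verts by (intro sum_strict_mono_ex1) auto
  then show ?thesis
    by (simp add: vertex_weight_def sum.distrib sum_distrib_left)
qed

text \<open>
  By convexity, a weight that does not decrease in the first step of a geodesic increases in all
  the later ones. Two nonadjacent minimizers of the weight are thus impossible.
\<close>

lemma weight_grows:
  assumes "(a, b) \<in> parcs T" "w \<in> pverts T" "graph_dist T a w = Suc (graph_dist T b w)"
    and "vertex_weight T a \<le> vertex_weight T b" "b \<noteq> w"
  shows "vertex_weight T b < vertex_weight T w"
  using assms
proof (induction "graph_dist T b w" arbitrary: a b rule: less_induct)
  case less
  obtain c where c: "(b, c) \<in> parcs T" "graph_dist T b w = Suc (graph_dist T c w)"
    using geodesic_step less.prems in_arcsD2 by metis
  have "a \<noteq> c"
    using less.prems(3) c(2) by auto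
  then have "vertex_weight T b < vertex_weight T c"
    using weight_strictly_convex[of b a c] arcs_symmetric less.prems c(1) by fastforce
  then show ?case
    using less.hyps[of c b] less.prems(2) c by (cases "c = w") auto
qed

lemma weight_centers_in_verts: "weight_centers T \<subseteq> pverts T"
  by (auto simp: weight_centers_def)

lemma weight_centers_nonempty: "weight_centers T \<noteq> {}"
proof -
  have "\<exists>u. is_arg_min (vertex_weight T) (\<lambda>u. u \<in> pverts T) u"
    using pair_finite_verts verts_nonempty ex_is_arg_min_if_finite by blast
  then show ?thesis
    by (auto simp: weight_centers_def is_arg_min_linorder)
qed

lemma weight_centers_adjacent:
  assumes "u \<in> weight_centers T" "w \<in> weight_centers T" "u \<noteq> w"
  shows "(u, w) \<in> parcs T"
proof -
  have verts: "u \<in> pverts T" "w \<in> pverts T"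
    using assms weight_centers_in_verts by auto
  obtain b where b: "(u, b) \<in> parcs T" "graph_dist T u w = Suc (graph_dist T b w)"
    using geodesic_step[OF verts assms(3)] .
  have "b \<in> pverts T"
    using b(1) by (rule in_arcsD2)
  then have "vertex_weight T u \<le> vertex_weight T b" "\<not> vertex_weight T b < vertex_weight T w"
    using assms(1,2) verts by (auto simp: weight_centers_def not_less)
  then have "b = w"
    using weight_grows[OF b(1) verts(2) b(2)] by blast
  then show ?thesis
    using b by simp
qed

lemma weight_centers_cases:
  obtains (single) w where "weight_centers T = {w}" "w \<in> pverts T"
  | (double) w w' where "weight_centers T = {w, w'}" "w \<noteq> w'" "(w, w') \<in> parcs T"
proof -
  obtain w where w: "w \<in> weight_centers T"
    using weight_centers_nonempty by blast
  show thesis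
  proof (cases "weight_centers T = {w}")
    case True
    then show thesis
      using single w weight_centers_in_verts by blast
  next
    case False
    then obtain w' where w': "w' \<in> weight_centers T" "w' \<noteq> w"
      using w by blast
    \<comment> \<open>A third center would be adjacent to the first one like the second, against convexity.\<close>
    have "x = w'" if x: "x \<in> weight_centers T" "x \<noteq> w" for x
    proof (rule ccontr)
      assume "x \<noteq> w'"
      then have "2 * vertex_weight T w < vertex_weight T x + vertex_weight T w'"
        using weight_strictly_convex weight_centers_adjacent x w w' by metis
      moreover have "vertex_weight T x \<le> vertex_weight T w" "vertex_weight T w' \<le> vertex_weight T w"
        using x w w' by (auto simp: weight_centers_def)
      ultimately show False
        by linarith
    qed
    then have "weight_centers T = {w, w'}"
      using w w' by blast
    then show thesis
      using double w w' weight_centers_adjacent by metis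
  qed
qed

section \<open>Levels and branches\<close>

text \<open>
  A path that starts at \<open>w\<close> never returns to it, so by \<open>neighbours_separated\<close> the only neighbour of
  \<open>w\<close> that it can visit is its second vertex.
\<close>

lemma mem_branch_iff:
  assumes "weight_centers T = {w}" "(w, u) \<in> parcs T"
  shows "x \<in> branch T u \<longleftrightarrow> (u, x) \<in> (arcs_avoiding w)\<^sup>*"
proof -
  have "w \<noteq> u"
    using assms(2) no_loops' by blast
  show ?thesis
  proof
    assume "x \<in> branch T u"
    then obtain p where p: "apath w p x" "u \<in> set (pawalk_verts w p)"
      using assms(1) by (auto simp: branch_def)
    then obtain e q where pe: "p = e # q"
      using \<open>w \<noteq> u\<close> by (cases p) auto
    have e: "e = (w, snd e)" "(w, snd e) \<in> parcs T" "awalk (snd e) q x"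
        "w \<notin> set (pawalk_verts (snd e) q)"
      using p(1) unfolding pe apath_def by (auto simp: awalk_Cons_iff prod_eq_iff)
    have "u \<in> set (pawalk_verts (snd e) q)" "x \<in> set (pawalk_verts (snd e) q)"
      using p(2) \<open>w \<noteq> u\<close> e(1) walk_verts[OF e(3)] awlast_of_awalk[OF e(3)]
      unfolding pe by (auto simp: prod_eq_iff)
    then have reach: "(snd e, u) \<in> (arcs_avoiding w)\<^sup>*" "(snd e, x) \<in> (arcs_avoiding w)\<^sup>*"
      using walk_verts_reachable_avoiding[OF e(3,4)] by auto
    then have "snd e = u"
      using neighbours_separated[OF e(2) assms(2)] by blast
    then show "(u, x) \<in> (arcs_avoiding w)\<^sup>*"
      using reach by simp
  next
    assume "(u, x) \<in> (arcs_avoiding w)\<^sup>*"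
    then obtain q where q: "apath u q x" "w \<notin> set (pawalk_verts u q)"
      using avoiding_apath[of u w x] in_arcsD2[OF assms(2)] \<open>w \<noteq> u\<close> by metis
    have "apath w ((w, u) # q) x"
      using q assms(2) in_arcsD1 by (auto simp: apath_def awalk_Cons_iff)
    moreover have "u \<in> set (pawalk_verts w ((w, u) # q))"
      using walk_verts[OF awalkI_apath[OF q(1)]] by simp
    ultimately show "x \<in> branch T u"
      using assms(1) by (auto simp: branch_def intro!: exI[of _ "(w, u) # q"])
  qed
qed

text \<open>
  Both sides say that every walk from \<open>x\<close> to \<open>y\<close> passes through \<open>w\<close>.
\<close>

lemma different_branches_iff_dist:
  assumes W: "weight_centers T = {w}" and x: "x \<in> pverts T" and y: "y \<in> pverts T"
  shows "different_branches T x y \<longleftrightarrow> graph_dist T x y = graph_dist T x w + graph_dist T y w"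
proof (cases "x = w \<or> y = w")
  case True
  have "w \<in> pverts T"
    using W weight_centers_in_verts by blast
  then show ?thesis
    using True W x y dist_sym by (auto simp: different_branches_def)
next
  case False
  have w: "w \<in> pverts T"
    using W weight_centers_in_verts by blast
  have sym: "sym (arcs_avoiding w)"
    using arcs_symmetric by (auto intro: symI)
  have roots: "u \<in> branch_roots T \<longleftrightarrow> (w, u) \<in> parcs T" for u
    using W in_arcsD2 no_loops'[of w u] by (auto simp: branch_roots_def)
  have diff: "different_branches T x y \<longleftrightarrow>
      (\<exists>u u'. (w, u) \<in> parcs T \<and> (w, u') \<in> parcs T \<and> u \<noteq> u' \<and>
        (u, x) \<in> (arcs_avoiding w)\<^sup>* \<and> (u', y) \<in> (arcs_avoiding w)\<^sup>*)"
    using False W roots mem_branch_iff[OF W] unfolding different_branches_def by blast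
  show ?thesis
  proof
    assume "different_branches T x y"
    then obtain u u' where u: "(w, u) \<in> parcs T" "(w, u') \<in> parcs T" "u \<noteq> u'"
        "(u, x) \<in> (arcs_avoiding w)\<^sup>*" "(u', y) \<in> (arcs_avoiding w)\<^sup>*"
      using diff by blast
    have "(x, y) \<notin> (arcs_avoiding w)\<^sup>*"
    proof
      assume "(x, y) \<in> (arcs_avoiding w)\<^sup>*"
      then have "(u, u') \<in> (arcs_avoiding w)\<^sup>*"
        using u(4,5) sym by (meson rtrancl_trans symD sym_rtrancl)
      then show False
        using neighbours_separated u by blast
    qed
    then have "\<not> graph_dist T x y < graph_dist T x w + graph_dist T w y"
      using geodesic_avoids x y w False by blast
    then show "graph_dist T x y = graph_dist T x w + graph_dist T y w"
      using dist_triangle[OF x w y] dist_sym[OF y w] by simp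
  next
    assume eq: "graph_dist T x y = graph_dist T x w + graph_dist T y w"
    have first: "\<exists>u. (w, u) \<in> parcs T \<and> graph_dist T w z = Suc (graph_dist T u z) \<and>
        (u, z) \<in> (arcs_avoiding w)\<^sup>*" if z: "z \<in> pverts T" "z \<noteq> w" for z
    proof -
      obtain u where u: "(w, u) \<in> parcs T" "graph_dist T w z = Suc (graph_dist T u z)"
        using geodesic_step w z by metis
      moreover have "(u, z) \<in> (arcs_avoiding w)\<^sup>*"
        using u z w in_arcsD2 no_loops'[OF u(1)] by (intro geodesic_avoids) auto
      ultimately show ?thesis
        by blast
    qed
    obtain u where u: "(w, u) \<in> parcs T" "graph_dist T w x = Suc (graph_dist T u x)"
        "(u, x) \<in> (arcs_avoiding w)\<^sup>*"
      using first x False by blast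
    obtain u' where u': "(w, u') \<in> parcs T" "graph_dist T w y = Suc (graph_dist T u' y)"
        "(u', y) \<in> (arcs_avoiding w)\<^sup>*"
      using first y False by blast
    \<comment> \<open>Through a common first neighbour the route from x to y would be shorter by two.\<close>
    have "u \<noteq> u'"
    proof
      assume "u = u'"
      then have "graph_dist T x y \<le> graph_dist T u x + graph_dist T u' y"
        using dist_triangle[OF x in_arcsD2[OF u(1)] y] dist_sym[OF x in_arcsD2[OF u(1)]] by simp
      then show False
        using eq u(2) u'(2) dist_sym[OF w x] dist_sym[OF w y] by simp
    qed
    then show "different_branches T x y"
      using diff u u' by blast
  qed
qed

end

text \<open>
  To be applied to the edge between two weight centers. Deleting an edge \<open>ww'\<close> splits a tree into the vertices closer
  to \<open>w\<close> and those closer to \<open>w'\<close>; comparing distances is easier than handling components, and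
  \<open>component_iff_side\<close> shows that it amounts to the same.
\<close>

locale tree_edge = finite_tree T for T :: "'a pair_pre_digraph" +
  fixes w w' :: 'a
  assumes edge: "(w, w') \<in> parcs T"
begin

definition near_side :: "'a set" where
  "near_side = {x \<in> pverts T. graph_dist T x w < graph_dist T x w'}"

lemma ends: "w \<in> pverts T" "w' \<in> pverts T" "w \<noteq> w'"
  using edge in_arcsD1 in_arcsD2 no_loops' by auto

lemma dist_ends:
  assumes "x \<in> pverts T"
  shows "x \<in> near_side \<Longrightarrow> graph_dist T x w' = Suc (graph_dist T x w)"
    and "x \<notin> near_side \<Longrightarrow> graph_dist T x w = Suc (graph_dist T x w')"
proof -
  have "graph_dist T x w \<noteq> graph_dist T x w'"
    using adjacent_dist_neq[OF edge assms] dist_sym assms ends by metis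
  moreover have "graph_dist T x w \<le> Suc (graph_dist T x w')"
    using dist_adjacent_le[OF edge assms] dist_sym assms ends by metis
  moreover have "graph_dist T x w' \<le> Suc (graph_dist T x w)"
    using dist_adjacent_le[OF arcs_symmetric[OF edge] assms] dist_sym assms ends by metis
  ultimately show "x \<in> near_side \<Longrightarrow> graph_dist T x w' = Suc (graph_dist T x w)"
    and "x \<notin> near_side \<Longrightarrow> graph_dist T x w = Suc (graph_dist T x w')"
    using assms by (auto simp: near_side_def)
qed

text \<open>
  For an arc \<open>ab\<close> from the side of \<open>w\<close> to that of \<open>w'\<close>, comparison of distances forces
  \<open>d(a, w) = d(b, w')\<close>, hence \<open>b\<close> is the parent of \<open>a\<close> with respect to \<open>w'\<close>. If \<open>a\<close> were not \<open>w\<close>, its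
  parent with respect to \<open>w\<close> would be another such parent.
\<close>

lemma crossing_arc:
  assumes "(a, b) \<in> parcs T" "a \<in> near_side" "b \<notin> near_side"
  shows "a = w \<and> b = w'"
proof -
  have verts: "a \<in> pverts T" "b \<in> pverts T"
    using assms(1) in_arcsD1 in_arcsD2 by auto
  have dists: "graph_dist T a w' = Suc (graph_dist T a w)" "graph_dist T b w = Suc (graph_dist T b w')"
    using dist_ends verts assms by auto
  have eq: "graph_dist T a w = graph_dist T b w'"
    using dists dist_adjacent_le[OF assms(1) ends(2)]
      dist_adjacent_le[OF arcs_symmetric[OF assms(1)] ends(1)] by simp
  have "a = w"
  proof (rule ccontr)
    assume "a \<noteq> w"
    then obtain c where c: "(a, c) \<in> parcs T" "graph_dist T a w = Suc (graph_dist T c w)"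
      using geodesic_step verts ends by metis
    have "graph_dist T c w' \<le> Suc (graph_dist T c w)"
      using dist_ends[OF in_arcsD2[OF c(1)]] by (cases "c \<in> near_side") auto
    then have "b = c"
      using closer_neighbour_unique[of a b c w'] assms(1) c dists(1) eq ends by simp
    then show False
      using c(2) dists(2) eq by simp
  qed
  moreover from this have "b = w'"
    using eq dist_eq_0_iff verts ends by simp
  ultimately show ?thesis
    by simp
qed

lemma dist_across:
  assumes "x \<in> pverts T" "y \<in> pverts T" "x \<in> near_side" "y \<notin> near_side"
  shows "graph_dist T x y = graph_dist T x w + graph_dist T y w' + 1"
  using assms
proof (induction "graph_dist T x y" arbitrary: x rule: less_induct)
  case less
  have upper: "graph_dist T x y \<le> graph_dist T x w + graph_dist T y w' + 1"
    using dist_triangle[of x w y] dist_ends(2)[of y] dist_sym[of y w] less.prems ends by simp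
  obtain c where c: "(x, c) \<in> parcs T" "graph_dist T x y = Suc (graph_dist T c y)"
    using geodesic_step less.prems by metis
  have verts: "c \<in> pverts T"
    using c(1) by (rule in_arcsD2)
  have "graph_dist T x w + graph_dist T y w' + 1 \<le> graph_dist T x y"
  proof (cases "c \<in> near_side")
    case True
    then have "graph_dist T c y = graph_dist T c w + graph_dist T y w' + 1"
      using less.hyps[of c] less.prems c verts by simp
    then show ?thesis
      using c dist_adjacent_le[OF c(1) ends(1)] by simp
  next
    case False
    then have "x = w" "c = w'"
      using crossing_arc c less.prems by auto
    then show ?thesis
      using c(2) dist_sym[of y w'] less.prems ends by simp
  qed
  then show ?case
    using upper by simp
qed

text \<open>
  A geodesic from \<open>x\<close> to \<open>w\<close> could leave the side of \<open>w\<close> only along the edge \<open>ww'\<close>, that is, after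
  reaching \<open>w\<close>.
\<close>

lemma near_reaches_end:
  assumes "x \<in> near_side"
  shows "(x, w) \<in> (parcs (delete_edge T w w'))\<^sup>*"
  using assms
proof (induction "graph_dist T x w" arbitrary: x rule: less_induct)
  case less
  show ?case
  proof (cases "x = w")
    case False
    have x: "x \<in> pverts T"
      using less.prems by (simp add: near_side_def)
    obtain c where c: "(x, c) \<in> parcs T" "graph_dist T x w = Suc (graph_dist T c w)"
      using geodesic_step x ends False by metis
    have "c \<in> near_side"
    proof (rule ccontr)
      assume "c \<notin> near_side"
      then show False
        using crossing_arc c less.prems False by blast
    qed
    moreover have "x \<noteq> w'"
      using less.prems ends by (auto simp: near_side_def)
    then have "(x, c) \<in> parcs (delete_edge T w w')"
      using c False by (simp add: delete_edge_def)
    ultimately show ?thesis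
      using less.hyps[of c] c by (auto intro: converse_rtrancl_into_rtrancl)
  qed simp
qed

lemma reachable_stays_near:
  assumes "(x, y) \<in> (parcs (delete_edge T w w'))\<^sup>*" "x \<in> near_side"
  shows "y \<in> near_side"
  using assms
proof (induction rule: rtrancl_induct)
  case (step y z)
  then show ?case
    using crossing_arc[of y z] by (auto simp: delete_edge_def)
qed

end

context tree_edge
begin

text \<open>
  The far side of an edge is the near side of the reversed edge.
\<close>

interpretation flip: tree_edge T w' w
  by unfold_locales (rule arcs_symmetric[OF edge])

lemma flip_near_side: "x \<in> pverts T \<Longrightarrow> x \<in> flip.near_side \<longleftrightarrow> x \<notin> near_side"
  using dist_ends[of x] unfolding near_side_def flip.near_side_def by fastforce

lemma component_iff_side:
  assumes "x \<in> pverts T" "y \<in> pverts T"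
  shows "x \<rightarrow>\<^sup>*\<^bsub>with_proj (delete_edge T w w')\<^esub> y \<longleftrightarrow> (x \<in> near_side \<longleftrightarrow> y \<in> near_side)"
proof -
  let ?D = "delete_edge T w w'"
  have del: "delete_edge T w' w = ?D"
    by (auto simp: delete_edge_def)
  interpret D: pair_wf_digraph ?D
    by unfold_locales (auto simp: delete_edge_def dest: in_arcsD1 in_arcsD2)
  have reach: "x \<rightarrow>\<^sup>*\<^bsub>with_proj ?D\<^esub> y \<longleftrightarrow> (x, y) \<in> (parcs ?D)\<^sup>*" if "x \<in> pverts T" for x y
    using that D.reachable_conv' by (auto simp: delete_edge_def reachable_rtranclI)
  have "sym (parcs ?D)"
    using arcs_symmetric by (auto simp: delete_edge_def intro: symI)
  then have rev: "(x, y) \<in> (parcs ?D)\<^sup>* \<Longrightarrow> (y, x) \<in> (parcs ?D)\<^sup>*" for x y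
    by (metis symD sym_rtrancl)
  show ?thesis
  proof
    assume "x \<rightarrow>\<^sup>*\<^bsub>with_proj ?D\<^esub> y"
    then show "x \<in> near_side \<longleftrightarrow> y \<in> near_side"
      using reach assms rev reachable_stays_near by blast
  next
    assume same: "x \<in> near_side \<longleftrightarrow> y \<in> near_side"
    show "x \<rightarrow>\<^sup>*\<^bsub>with_proj ?D\<^esub> y"
    proof (cases "x \<in> near_side")
      case True
      then show ?thesis
        using same near_reaches_end rev reach assms by (meson rtrancl_trans)
    next
      case False
      then have "(x, w') \<in> (parcs ?D)\<^sup>*" "(y, w') \<in> (parcs ?D)\<^sup>*"
        using same flip_near_side flip.near_reaches_end assms del by auto
      then show ?thesis
        using rev reach assms by (meson rtrancl_trans)
    qed
  qed
qed

lemma dist_le_min_ends: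
  fixes x y
  assumes xy: "x \<in> pverts T" "y \<in> pverts T"
  defines "l \<equiv> \<lambda>x. min (graph_dist T x w) (graph_dist T x w')"
  shows "graph_dist T x y \<le> l x + l y + 1"
    and "graph_dist T x y = l x + l y + 1 \<longleftrightarrow> \<not> x \<rightarrow>\<^sup>*\<^bsub>with_proj (delete_edge T w w')\<^esub> y"
proof -
  have l: "l z = (if z \<in> near_side then graph_dist T z w else graph_dist T z w')"
    if "z \<in> pverts T" for z
    using dist_ends[OF that] by (auto simp: l_def)
  have same: "graph_dist T x y \<le> l x + l y" if "x \<in> near_side \<longleftrightarrow> y \<in> near_side"
    using that l xy dist_triangle[of x w y] dist_triangle[of x w' y] dist_sym[of y w]
      dist_sym[of y w'] ends by auto
  have across: "graph_dist T x y = l x + l y + 1" if "\<not> (x \<in> near_side \<longleftrightarrow> y \<in> near_side)"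
    using that l xy dist_across[of x y] dist_across[of y x] dist_sym[of x y] by auto
  show "graph_dist T x y \<le> l x + l y + 1"
    using same across by fastforce
  show "graph_dist T x y = l x + l y + 1 \<longleftrightarrow> \<not> x \<rightarrow>\<^sup>*\<^bsub>with_proj (delete_edge T w w')\<^esub> y"
    using same across component_iff_side[OF xy] by fastforce
qed

end

context finite_tree
begin

text \<open>
  If there are two weight centers, they are adjacent and \<open>epsilon\<close> is zero, so the path may cross
  one additional edge; this accounts for the uniform formula.
\<close>

lemma dist_le_levels:
  assumes xy: "x \<in> pverts T" "y \<in> pverts T"
  shows "graph_dist T x y + epsilon T \<le> level T x + level T y + 1"
    and "graph_dist T x y + epsilon T = level T x + level T y + 1 \<longleftrightarrow>
      (card (weight_centers T) = 1 \<longrightarrow> different_branches T x y) \<and>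
      (card (weight_centers T) = 2 \<longrightarrow> opposite_branches T x y)"
proof -
  show "graph_dist T x y + epsilon T \<le> level T x + level T y + 1"
  proof (cases rule: weight_centers_cases)
    case (single w)
    then show ?thesis
      using xy dist_triangle[of x w y] dist_sym[of y w] by (simp add: level_def epsilon_def)
  next
    case (double w w')
    interpret tree_edge T w w' by unfold_locales fact
    show ?thesis
      using double dist_le_min_ends(1)[OF xy] by (simp add: level_def epsilon_def)
  qed
  show "graph_dist T x y + epsilon T = level T x + level T y + 1 \<longleftrightarrow>
      (card (weight_centers T) = 1 \<longrightarrow> different_branches T x y) \<and>
      (card (weight_centers T) = 2 \<longrightarrow> opposite_branches T x y)"
  proof (cases rule: weight_centers_cases)
    case (single w)
    then show ?thesis
      using xy different_branches_iff_dist by (simp add: level_def epsilon_def)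
  next
    case (double w w')
    interpret tree_edge T w w' by unfold_locales fact
    have del: "delete_edge T w' w = delete_edge T w w'"
      by (auto simp: delete_edge_def)
    have "opposite_branches T x y \<longleftrightarrow> \<not> x \<rightarrow>\<^sup>*\<^bsub>with_proj (delete_edge T w w')\<^esub> y"
    proof -
      have "v = w \<and> v' = w' \<or> v = w' \<and> v' = w" if "weight_centers T = {v, v'}" for v v'
        using that double(1) by (metis doubleton_eq_iff)
      then show ?thesis
        using double(1,2) xy del unfolding opposite_branches_def by metis
    qed
    then show ?thesis
      using double dist_le_min_ends(2)[OF xy] by (simp add: level_def epsilon_def)
  qed
qed

end

section \<open>Radio labelings and orderings of the vertices\<close>

lemma sorted_enumeration:
  fixes f :: "'a \<Rightarrow> nat"
  assumes "finite A" "A \<noteq> {}"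
  obtains z where "bij_betw z {0..card A - 1} A" "\<And>t. t < card A - 1 \<Longrightarrow> f (z t) \<le> f (z (Suc t))"
proof -
  obtain xs where xs: "set xs = A" "distinct xs"
    using finite_distinct_list assms(1) by blast
  let ?ys = "sort_key f xs"
  have len: "length ?ys = card A"
    using xs distinct_card by fastforce
  moreover have "0 < card A"
    using assms by (simp add: card_gt_0_iff)
  ultimately have index: "{0..card A - 1} = {..<length ?ys}"
    by auto
  have "bij_betw ((!) ?ys) {0..card A - 1} A"
    unfolding index using xs by (intro bij_betw_nth) auto
  moreover have "f (?ys ! t) \<le> f (?ys ! Suc t)" if "t < card A - 1" for t
    using sorted_nth_mono[OF sorted_sort_key[of f xs], of t "Suc t"] that len by simp
  ultimately show thesis
    by (rule that)
qed

lemma monotone_along: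
  fixes f :: "'a \<Rightarrow> nat"
  assumes "\<And>t. t < M \<Longrightarrow> f (z t) \<le> f (z (Suc t))" "s \<le> t" "t \<le> M"
  shows "f (z s) \<le> f (z t)"
  using assms(2,3)
proof (induction rule: dec_induct)
  case (step t)
  then show ?case
    using assms(1)[of t] by simp
qed simp

context connected_graph
begin

lemma finite_label_differences:
  "finite {nat \<bar>int (f u) - int (f v)\<bar> | u v. u \<in> pverts G \<and> v \<in> pverts G}"
  by (intro finite_image_set2) (simp_all add: pair_finite_verts)

lemma label_span_ordered:
  assumes z: "bij_betw z {0..M} (pverts G)"
    and mono: "\<And>t. t < M \<Longrightarrow> f (z t) \<le> f (z (Suc t))"
  shows "int (label_span G f) = int (f (z M)) - int (f (z 0))"
proof -
  have range: "f (z 0) \<le> f v \<and> f v \<le> f (z M)" if v: "v \<in> pverts G" for v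
  proof -
    obtain t where "v = z t" "t \<le> M"
      using v bij_betw_imp_surj_on[OF z] by (metis atLeastAtMost_iff imageE)
    then show ?thesis
      using monotone_along[where f = f and z = z, OF mono] by simp
  qed
  have ends: "z 0 \<in> pverts G" "z M \<in> pverts G"
    using z by (auto simp: bij_betw_def)
  have "label_span G f = nat \<bar>int (f (z M)) - int (f (z 0))\<bar>"
    unfolding label_span_def
  proof (rule Max_eqI)
    show "finite {nat \<bar>int (f u) - int (f v)\<bar> | u v. u \<in> pverts G \<and> v \<in> pverts G}"
      by (rule finite_label_differences)
    show "nat \<bar>int (f (z M)) - int (f (z 0))\<bar>
        \<in> {nat \<bar>int (f u) - int (f v)\<bar> | u v. u \<in> pverts G \<and> v \<in> pverts G}"
      using ends by blast
    show "d \<le> nat \<bar>int (f (z M)) - int (f (z 0))\<bar>"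
      if "d \<in> {nat \<bar>int (f u) - int (f v)\<bar> | u v. u \<in> pverts G \<and> v \<in> pverts G}" for d
    proof -
      obtain u v where "d = nat \<bar>int (f u) - int (f v)\<bar>" "u \<in> pverts G" "v \<in> pverts G"
        using \<open>d \<in> _\<close> by blast
      then show ?thesis
        using range[of u] range[of v] by linarith
    qed
  qed
  then show ?thesis
    using range[OF ends(2)] by simp
qed

lemma radio_labeling_exists: "\<exists>f. radio_labeling G f"
proof -
  obtain g :: "'a \<Rightarrow> nat" where g: "inj_on g (pverts G)"
    using finite_imp_inj_to_nat_seg pair_finite_verts by blast
  \<comment> \<open>Labels that are pairwise at least diameter + 1 apart meet the condition for every distance.\<close>
  have "radio_labeling G (\<lambda>v. (diameter G + 1) * g v)"
    unfolding radio_labeling_def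
  proof (intro ballI impI)
    fix u v assume uv: "u \<in> pverts G" "v \<in> pverts G" "u \<noteq> v"
    then have "g u \<noteq> g v"
      using g by (auto dest: inj_onD)
    then have "1 \<le> \<bar>int (g u) - int (g v)\<bar>"
      by simp
    then have "int (diameter G + 1) * 1 \<le> int (diameter G + 1) * \<bar>int (g u) - int (g v)\<bar>"
      by (intro mult_left_mono) simp_all
    also have "\<dots> = \<bar>int ((diameter G + 1) * g u) - int ((diameter G + 1) * g v)\<bar>"
      unfolding of_nat_mult right_diff_distrib[symmetric] abs_mult by simp
    finally show "int (diameter G) + 1 - int (graph_dist G u v)
        \<le> \<bar>int ((diameter G + 1) * g u) - int ((diameter G + 1) * g v)\<bar>"
      by simp
  qed
  then show ?thesis
    by blast
qed

lemma radio_number_attained: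
  obtains f where "radio_labeling G f" "label_span G f = radio_number G"
proof -
  have "\<exists>s f. radio_labeling G f \<and> label_span G f = s"
    using radio_labeling_exists by blast
  then have "\<exists>f. radio_labeling G f \<and> label_span G f = radio_number G"
    unfolding radio_number_def by (rule LeastI_ex)
  then show thesis
    using that by blast
qed

lemma radio_number_le: "radio_labeling G f \<Longrightarrow> radio_number G \<le> label_span G f"
  unfolding radio_number_def by (rule Least_le) blast

end

section \<open>The product of a graph and a tree\<close>

locale graph_times_tree = G: connected_graph G + T: finite_tree T
  for G :: "'a pair_pre_digraph" and T :: "'b pair_pre_digraph"

sublocale graph_times_tree \<subseteq> connected_graph_pair G T ..

context graph_times_tree
begin

definition last_index :: nat where
  "last_index = card (pverts G) * card (pverts T) - 1"

definition span_bound :: int where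
  "span_bound = int last_index * (int (diameter T) + int (epsilon T))
     - 2 * int (card (pverts G)) * int (total_level T)"

text \<open>
  The increment of the labels in a labeling that attains the bound.
\<close>

definition tree_gap :: "'a \<times> 'b \<Rightarrow> 'a \<times> 'b \<Rightarrow> int" where
  "tree_gap p q = int (diameter T) + int (epsilon T)
     - int (level T (snd p)) - int (level T (snd q))"

definition tight_pair :: "'a \<times> 'b \<Rightarrow> 'a \<times> 'b \<Rightarrow> bool" where
  "tight_pair p q \<longleftrightarrow> graph_dist G (fst p) (fst q) = diameter G \<and>
     (card (weight_centers T) = 1 \<longrightarrow> different_branches T (snd p) (snd q)) \<and>
     (card (weight_centers T) = 2 \<longrightarrow> opposite_branches T (snd p) (snd q))"

lemma card_product: "card (pverts (G \<box> T)) = Suc last_index"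
proof -
  have "0 < card (pverts G)" "0 < card (pverts T)"
    using G.verts_nonempty G.pair_finite_verts T.verts_nonempty T.pair_finite_verts
    by (simp_all add: card_gt_0_iff)
  then show ?thesis
    by (simp add: last_index_def card_cartesian_product)
qed

lemma ordering_verts:
  assumes "bij_betw z {0..last_index} (pverts (G \<box> T))" "t < last_index"
  shows "z t \<in> pverts (G \<box> T)" "z (Suc t) \<in> pverts (G \<box> T)" "z t \<noteq> z (Suc t)"
proof -
  show "z t \<in> pverts (G \<box> T)" "z (Suc t) \<in> pverts (G \<box> T)"
    using assms bij_betwE by fastforce+
  show "z t \<noteq> z (Suc t)"
    using assms by (auto simp: bij_betw_def dest: inj_onD)
qed

text \<open>
  Each vertex occurs in two consecutive pairs, except that the two end vertices occur in one; their
  levels are therefore added back.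
\<close>

lemma sum_tree_gaps:
  assumes z: "bij_betw z {0..last_index} (pverts (G \<box> T))"
  shows "(\<Sum>t<last_index. tree_gap (z t) (z (Suc t)))
    = span_bound + int (level T (snd (z 0))) + int (level T (snd (z last_index)))"
proof -
  let ?l = "\<lambda>t. int (level T (snd (z t)))"
  have index: "{0..last_index} = {..<Suc last_index}"
    by auto
  have "(\<Sum>t<Suc last_index. ?l t) = (\<Sum>p\<in>pverts G \<times> pverts T. int (level T (snd p)))"
    using sum.reindex_bij_betw[OF z, of "\<lambda>p. int (level T (snd p))"] unfolding index by simp
  also have "\<dots> = (\<Sum>g\<in>pverts G. \<Sum>h\<in>pverts T. int (level T h))"
    unfolding sum.cartesian_product by (rule sum.cong) auto
  also have "\<dots> = int (card (pverts G)) * int (total_level T)"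
    by (simp add: total_level_def)
  finally have total: "(\<Sum>t<Suc last_index. ?l t) = int (card (pverts G)) * int (total_level T)" .
  have "(\<Sum>t<last_index. ?l t) + ?l last_index = (\<Sum>t<Suc last_index. ?l t)"
    by simp
  moreover have "?l 0 + (\<Sum>t<last_index. ?l (Suc t)) = (\<Sum>t<Suc last_index. ?l t)"
    by (simp only: sum.lessThan_Suc_shift)
  ultimately show ?thesis
    using total
    by (simp add: tree_gap_def span_bound_def sum_subtractf sum.distrib)
qed

text \<open>
  The labels of \<open>p\<close> and \<open>q\<close> differ by at least the tree gap plus the two defects
  \<open>diameter G - d\<^sub>G\<close> and \<open>level + level + 1 - epsilon T - d\<^sub>T\<close>. Both are nonnegative, and in the
  case of equality both vanish.
\<close>

lemma radio_gap:
  assumes radio: "radio_labeling (G \<box> T) f"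
    and pq: "p \<in> pverts (G \<box> T)" "q \<in> pverts (G \<box> T)" "p \<noteq> q" "f p \<le> f q"
  shows "tree_gap p q \<le> int (f q) - int (f p)"
    and "int (f q) - int (f p) = tree_gap p q \<Longrightarrow> tight_pair p q"
proof -
  have verts: "fst p \<in> pverts G" "fst q \<in> pverts G" "snd p \<in> pverts T" "snd q \<in> pverts T"
    using pq by auto
  have "int (diameter (G \<box> T)) + 1 - int (graph_dist (G \<box> T) p q) \<le> \<bar>int (f p) - int (f q)\<bar>"
    using radio pq unfolding radio_labeling_def by blast
  then have gap: "int (diameter G) + int (diameter T) + 1
      - int (graph_dist G (fst p) (fst q)) - int (graph_dist T (snd p) (snd q))
      \<le> int (f q) - int (f p)"
    using pq by (simp add: diameter_product dist_product)
  note slack_G = G.dist_le_diameter[OF verts(1,2)]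
  note slack_T = T.dist_le_levels(1)[OF verts(3,4)]
  show "tree_gap p q \<le> int (f q) - int (f p)"
    using gap slack_G slack_T by (simp add: tree_gap_def)
  assume "int (f q) - int (f p) = tree_gap p q"
  then have "graph_dist G (fst p) (fst q) = diameter G"
      "graph_dist T (snd p) (snd q) + epsilon T = level T (snd p) + level T (snd q) + 1"
    using gap slack_G slack_T by (simp_all add: tree_gap_def)
  then show "tight_pair p q"
    using T.dist_le_levels(2)[OF verts(3,4)] by (simp add: tight_pair_def)
qed

text \<open>
  For a tight pair the gap equals \<open>diameter T + 1 - d\<close> where \<open>d\<close> is the distance of the tree
  coordinates. Thus labels that grow by these gaps are monotone along the ordering.
\<close>

lemma tree_gap_nonneg:
  assumes "p \<in> pverts (G \<box> T)" "q \<in> pverts (G \<box> T)" "tight_pair p q"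
  shows "0 \<le> tree_gap p q"
proof -
  have verts: "snd p \<in> pverts T" "snd q \<in> pverts T"
    using assms by auto
  have "graph_dist T (snd p) (snd q) + epsilon T = level T (snd p) + level T (snd q) + 1"
    using T.dist_le_levels(2)[OF verts] assms(3) by (simp add: tight_pair_def)
  then show ?thesis
    using T.dist_le_diameter[OF verts] by (simp add: tree_gap_def)
qed

lemma span_ge_bound:
  assumes radio: "radio_labeling (G \<box> T) f"
    and z: "bij_betw z {0..last_index} (pverts (G \<box> T))"
    and mono: "\<And>t. t < last_index \<Longrightarrow> f (z t) \<le> f (z (Suc t))"
  shows "span_bound \<le> int (label_span (G \<box> T) f)"
    and "int (label_span (G \<box> T) f) = span_bound \<Longrightarrow>
      level T (snd (z 0)) + level T (snd (z last_index)) = 0 \<and>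
      (\<forall>t<last_index. int (f (z (Suc t))) - int (f (z t)) = tree_gap (z t) (z (Suc t)))"
proof -
  let ?diff = "\<lambda>t. int (f (z (Suc t))) - int (f (z t))"
  have span: "int (label_span (G \<box> T) f) = (\<Sum>t<last_index. ?diff t)"
    using product.label_span_ordered[OF z mono]
    by (simp add: sum_lessThan_telescope[of "\<lambda>t. int (f (z t))"])
  have gaps: "tree_gap (z t) (z (Suc t)) \<le> ?diff t" if "t < last_index" for t
    using radio_gap(1)[OF radio] ordering_verts[OF z that] mono[OF that] by blast
  have sum_le: "(\<Sum>t<last_index. tree_gap (z t) (z (Suc t))) \<le> (\<Sum>t<last_index. ?diff t)"
    using gaps by (intro sum_mono) simp
  then show "span_bound \<le> int (label_span (G \<box> T) f)"
    using span sum_tree_gaps[OF z] by simp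
  assume tight: "int (label_span (G \<box> T) f) = span_bound"
  have ends: "level T (snd (z 0)) + level T (snd (z last_index)) = 0"
    using tight sum_le span sum_tree_gaps[OF z] by simp
  then have "(\<Sum>t<last_index. tree_gap (z t) (z (Suc t))) = (\<Sum>t<last_index. ?diff t)"
    using tight span sum_tree_gaps[OF z] by simp
  then have "tree_gap (z t) (z (Suc t)) = ?diff t" if "t < last_index" for t
    using sum_mono_inv[of "\<lambda>t. tree_gap (z t) (z (Suc t))" "{..<last_index}" ?diff t] gaps that
    by simp
  then show "level T (snd (z 0)) + level T (snd (z last_index)) = 0 \<and>
      (\<forall>t<last_index. ?diff t = tree_gap (z t) (z (Suc t)))"
    using ends by simp
qed

lemma optimal_ordering:
  obtains f z where "radio_labeling (G \<box> T) f" "label_span (G \<box> T) f = radio_number (G \<box> T)"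
    "bij_betw z {0..last_index} (pverts (G \<box> T))" "\<And>t. t < last_index \<Longrightarrow> f (z t) \<le> f (z (Suc t))"
proof -
  obtain f where f: "radio_labeling (G \<box> T) f" "label_span (G \<box> T) f = radio_number (G \<box> T)"
    by (rule product.radio_number_attained)
  obtain z where "bij_betw z {0..last_index} (pverts (G \<box> T))"
      "\<And>t. t < last_index \<Longrightarrow> f (z t) \<le> f (z (Suc t))"
    using sorted_enumeration[of "pverts (G \<box> T)" f] product.pair_finite_verts product.verts_nonempty
    unfolding card_product by auto
  then show thesis
    using that f by blast
qed

theorem radio_number_ge: "span_bound \<le> int (radio_number (G \<box> T))"
  using optimal_ordering span_ge_bound(1) by metis

text \<open>
  For the first direction, order the vertices by an optimal labeling: the increments are bounded
  below termwise and agree in total, hence agree termwise. A shift by the smallest label normalizes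
  the labeling to start at zero.
\<close>

theorem radio_number_eq_iff:
  "int (radio_number (G \<box> T)) = span_bound \<longleftrightarrow>
    (\<exists>z. bij_betw z {0..last_index} (pverts (G \<box> T)) \<and>
       (\<forall>t<last_index. tight_pair (z t) (z (Suc t))) \<and>
       level T (snd (z 0)) + level T (snd (z last_index)) = 0 \<and>
       (\<exists>f. f (z 0) = 0 \<and>
          (\<forall>t<last_index. int (f (z (Suc t))) - int (f (z t)) = tree_gap (z t) (z (Suc t))) \<and>
          radio_labeling (G \<box> T) f))"
  (is "?eq \<longleftrightarrow> (\<exists>z. ?bij z \<and> ?tight z \<and> ?ends z \<and> (\<exists>f. ?start z f \<and> ?gaps z f \<and> ?radio f))")
proof
  assume eq: ?eq
  obtain f z where f: "?radio f" "label_span (G \<box> T) f = radio_number (G \<box> T)"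
    and z: "?bij z" and mono: "\<And>t. t < last_index \<Longrightarrow> f (z t) \<le> f (z (Suc t))"
    by (rule optimal_ordering) auto
  have ends: "?ends z" and gaps: "?gaps z f"
    using span_ge_bound(2)[OF f(1) z mono] f(2) eq by simp_all
  have tight: "?tight z"
    using radio_gap(2)[OF f(1)] ordering_verts[OF z] mono gaps by blast
  let ?f = "\<lambda>p. f p - f (z 0)"
  have shift: "int (?f (z t)) = int (f (z t)) - int (f (z 0))" if "t \<le> last_index" for t
  proof -
    have "f (z 0) \<le> f (z t)"
      using monotone_along[of last_index f z 0 t] mono that by blast
    then show ?thesis
      by simp
  qed
  have shift_verts: "int (?f p) = int (f p) - int (f (z 0))" if "p \<in> pverts (G \<box> T)" for p
    using shift z that unfolding bij_betw_def by (metis atLeastAtMost_iff imageE)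
  have "?gaps z ?f"
  proof (intro allI impI)
    fix t assume t: "t < last_index"
    show "int (?f (z (Suc t))) - int (?f (z t)) = tree_gap (z t) (z (Suc t))"
      using gaps t shift[of t] shift[of "Suc t"] by simp
  qed
  moreover have "?radio ?f"
    using f(1) shift_verts unfolding radio_labeling_def by simp
  ultimately show "\<exists>z. ?bij z \<and> ?tight z \<and> ?ends z \<and> (\<exists>f. ?start z f \<and> ?gaps z f \<and> ?radio f)"
    using z tight ends by (intro exI[of _ z] conjI exI[of _ ?f]) simp_all
next
  assume "\<exists>z. ?bij z \<and> ?tight z \<and> ?ends z \<and> (\<exists>f. ?start z f \<and> ?gaps z f \<and> ?radio f)"
  then obtain z f where z: "?bij z" "?tight z" "?ends z"
    and f: "?start z f" "?gaps z f" "?radio f"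
    by (elim exE conjE)
  have mono: "f (z t) \<le> f (z (Suc t))" if "t < last_index" for t
    using tree_gap_nonneg ordering_verts[OF z(1) that] z(2) f(2) that by fastforce
  have "int (label_span (G \<box> T) f) = (\<Sum>t<last_index. int (f (z (Suc t))) - int (f (z t)))"
    using product.label_span_ordered[OF z(1) mono]
    by (simp add: sum_lessThan_telescope[of "\<lambda>t. int (f (z t))"])
  also have "\<dots> = span_bound"
    using f(2) sum_tree_gaps[OF z(1)] z(3) by simp
  finally show ?eq
    using product.radio_number_le[OF f(3)] radio_number_ge by linarith
qed

end

section \<open>Generalized Petersen graphs\<close>

lemma pverts_petersen: "pverts (petersen m k) = Outer ` {..<m} \<union> Inner ` {..<m}"
  by (simp add: petersen_def Let_def)

lemma card_petersen: "card (pverts (petersen m k)) = 2 * m"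
  unfolding pverts_petersen
  by (subst card_Un_disjoint) (auto simp: card_image inj_on_def)

lemma petersen_connected_graph:
  assumes "0 < m"
  shows "connected_graph (petersen m k)"
proof
  let ?P = "petersen m k"
  show wf: "fst e \<in> pverts ?P" "snd e \<in> pverts ?P" if "e \<in> parcs ?P" for e
    using that assms by (auto simp: petersen_def Let_def)
  show fin: "finite (pverts ?P)"
    by (simp add: pverts_petersen)
  have "parcs ?P \<subseteq> pverts ?P \<times> pverts ?P"
    using wf by (metis mem_Times_iff subsetI)
  then show "finite (parcs ?P)"
    using fin by (meson finite_SigmaI finite_subset)
  have sym: "sym (parcs ?P)"
    unfolding petersen_def Let_def by (simp add: sym_Un_converse)
  then show "symmetric (with_proj ?P)"
    by (simp add: symmetric_def)
  show "pverts ?P \<noteq> {}"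
    using assms by (auto simp: pverts_petersen)
  have outer: "(Outer 0, Outer i) \<in> (parcs ?P)\<^sup>*" if "i < m" for i
    using that
  proof (induction i)
    case (Suc i)
    then have "(Outer i, Outer (Suc i)) \<in> parcs ?P"
      by (auto simp: petersen_def Let_def intro!: exI[of _ i])
    then show ?case
      using Suc by (simp add: rtrancl_into_rtrancl)
  qed simp
  have inner: "(Outer 0, Inner i) \<in> (parcs ?P)\<^sup>*" if "i < m" for i
  proof -
    have "(Outer i, Inner i) \<in> parcs ?P"
      using that by (simp add: petersen_def Let_def)
    then show ?thesis
      using outer[OF that] by (simp add: rtrancl_into_rtrancl)
  qed
  have root: "(Outer 0, v) \<in> (parcs ?P)\<^sup>*" if "v \<in> pverts ?P" for v
    using that outer inner by (auto simp: pverts_petersen)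
  show "(u, v) \<in> (parcs ?P)\<^sup>*" if "u \<in> pverts ?P" "v \<in> pverts ?P" for u v
    using root[OF that(1)] root[OF that(2)] sym by (meson rtrancl_trans symD sym_rtrancl)
qed

theorem theorem3p1:
  fixes m k n :: nat and T :: "'a pair_pre_digraph"
  assumes "3 \<le> m" and "1 \<le> k"
    and "undirected_tree T" and "card (pverts T) = n"
  shows
    "int (radio_number (petersen m k \<box> T)) \<ge>
       (2 * int m * int n - 1) * (int (diameter T) + int (epsilon T))
         - 4 * int m * int (total_level T)
     \<and>
     (int (radio_number (petersen m k \<box> T)) =
        (2 * int m * int n - 1) * (int (diameter T) + int (epsilon T))
          - 4 * int m * int (total_level T)
      \<longleftrightarrow>
      (\<exists>z :: nat \<Rightarrow> petersen_vertex \<times> 'a.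
         bij_betw z {0..2 * m * n - 1} (pverts (petersen m k \<box> T)) \<and>
         (\<forall>t. t + 1 \<le> 2 * m * n - 1 \<longrightarrow>
            graph_dist (petersen m k) (fst (z t)) (fst (z (t + 1))) = diameter (petersen m k)) \<and>
         level T (snd (z 0)) + level T (snd (z (2 * m * n - 1))) = 0 \<and>
         (\<forall>t. t + 1 \<le> 2 * m * n - 1 \<longrightarrow>
            (card (weight_centers T) = 1 \<longrightarrow> different_branches T (snd (z t)) (snd (z (t + 1)))) \<and>
            (card (weight_centers T) = 2 \<longrightarrow> opposite_branches T (snd (z t)) (snd (z (t + 1))))) \<and>
         (\<exists>f. f (z 0) = 0 \<and>
            (\<forall>t. t + 1 \<le> 2 * m * n - 1 \<longrightarrow>
               int (f (z (t + 1))) =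
                 int (f (z t)) + int (diameter T) + int (epsilon T)
                   - int (level T (snd (z t))) - int (level T (snd (z (t + 1))))) \<and>
            radio_labeling (petersen m k \<box> T) f)))"
proof -
  interpret graph_times_tree "petersen m k" T
    using petersen_connected_graph assms by (simp add: graph_times_tree_def finite_tree_def)
  have last: "2 * m * n - 1 = last_index"
    by (simp add: last_index_def card_petersen assms(4))
  have "0 < n"
    using assms(4) T.verts_nonempty T.pair_finite_verts by (auto simp: card_gt_0_iff)
  then have "int last_index = 2 * int m * int n - 1"
    using assms(1) by (simp add: last_index_def card_petersen assms(4) of_nat_diff)
  then have bound: "(2 * int m * int n - 1) * (int (diameter T) + int (epsilon T))
      - 4 * int m * int (total_level T) = span_bound"
    by (simp add: span_bound_def card_petersen)
  have le: "t + 1 \<le> last_index \<longleftrightarrow> t < last_index" for t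
    by auto
  have gap: "int (f (z (t + 1))) = int (f (z t)) + int (diameter T) + int (epsilon T)
        - int (level T (snd (z t))) - int (level T (snd (z (t + 1))))
      \<longleftrightarrow> int (f (z (Suc t))) - int (f (z t)) = tree_gap (z t) (z (Suc t))"
    for f and z :: "nat \<Rightarrow> petersen_vertex \<times> 'a" and t
    by (auto simp: tree_gap_def)
  show ?thesis
    unfolding bound last le gap radio_number_eq_iff tight_pair_def
    using radio_number_ge by auto
qed

end
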